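(* The Fatou set $\mathcal{F}_{A,B,C,D}$ is non-empty for any $(A,B,C,D)$ in an open neighborhood in $\mathbb{C}^4$ of (1) any parameters $(0,0,0,D_0)$ with $D_0\in\mathbb{C}$, $D_0\neq 4$, and (2) any parameters $(A(a),B(a),C(a),D(a))$ with $a\in(-2,2)$, where $A(a)=B(a)=C(a)=2a+4$ and $D(a)=-(a^2+8a+8)$. That is, each parameter listed in (1) and (2) has an open neighborhood $W\subset\mathbb{C}^4$ such that $\mathcal{F}_{A,B,C,D}\neq\emptyset$ for all $(A,B,C,D)\in W$.
   Context: For $(A,B,C,D)\in\mathbb{C}^4$ let $S_{A,B,C,D}=\{(x,y,z)\in\mathbb{C}^3: x^2+y^2+z^2+xyz=Ax+By+Cz+D\}$. The involutions $s_x(x,y,z)=(-x-yz+A,\,y,\,z)$, $s_y(x,y,z)=(x,\,-y-xz+B,\,z)$, $s_z(x,y,z)=(x,\,y,\,-z-xy+C)$ preserve $S_{A,B,C,D}$. Let $\mathcal{G}_{A,B,C,D}=\langle g_x,g_y,g_z\rangle$ be the group of automorphisms of $S_{A,B,C,D}$ generated by $g_x=s_z\circ s_y$, $g_y=s_x\circ s_z$, $g_z=s_y\circ s_x$. A sequence of maps $f_i$ converges to infinity on an open set $U\subset S_{A,B,C,D}$ if for every compact $\overline V\subset U$ and every compact $K\subset S_{A,B,C,D}$ only finitely many $i$ satisfy $f_i(\overline V)\cap K\neq\emptyset$. The group $\mathcal{G}_{A,B,C,D}$ forms a normal family on $U$ if every sequence of its elements has a subsequence that, on $U$, either converges uniformly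 on compact subsets or converges to infinity. The Fatou set $\mathcal{F}_{A,B,C,D}$ is the set of $p\in S_{A,B,C,D}$ having an open neighborhood on which $\mathcal{G}_{A,B,C,D}$ forms a normal family. *)

theory Defs
  imports "HOL-Algebra.Bij" "HOL-Algebra.Generated_Groups" "HOL-Analysis.Analysis"
begin

type_synonym point = "complex \<times> complex \<times> complex"

definition cubic_surface :: "complex \<Rightarrow> complex \<Rightarrow> complex \<Rightarrow> complex \<Rightarrow> point set" where
  "cubic_surface A B C D =
     {(x, y, z). x\<^sup>2 + y\<^sup>2 + z\<^sup>2 + x * y * z = A * x + B * y + C * z + D}"

definition sx :: "complex \<Rightarrow> point \<Rightarrow> point" where
  "sx A = (\<lambda>(x, y, z). (- x - y * z + A, y, z))"

definition sy :: "complex \<Rightarrow> point \<Rightarrow> point" where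
  "sy B = (\<lambda>(x, y, z). (x, - y - x * z + B, z))"

definition sz :: "complex \<Rightarrow> point \<Rightarrow> point" where
  "sz C = (\<lambda>(x, y, z). (x, y, - z - x * y + C))"

definition gx :: "complex \<Rightarrow> complex \<Rightarrow> complex \<Rightarrow> complex \<Rightarrow> point \<Rightarrow> point" where
  "gx A B C D = restrict (sz C \<circ> sy B) (cubic_surface A B C D)"

definition gy :: "complex \<Rightarrow> complex \<Rightarrow> complex \<Rightarrow> complex \<Rightarrow> point \<Rightarrow> point" where
  "gy A B C D = restrict (sx A \<circ> sz C) (cubic_surface A B C D)"

definition gz :: "complex \<Rightarrow> complex \<Rightarrow> complex \<Rightarrow> complex \<Rightarrow> point \<Rightarrow> point" where
  "gz A B C D = restrict (sy B \<circ> sx A) (cubic_surface A B C D)"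

text \<open>
  The generators are polynomial automorphisms of the surface, so the group they generate among
  its algebraic automorphisms coincides with the one they generate among all its bijections.
  Elements of the latter are functions that are \<^const>\<open>undefined\<close> off the surface.
\<close>

definition aut_group :: "complex \<Rightarrow> complex \<Rightarrow> complex \<Rightarrow> complex \<Rightarrow> (point \<Rightarrow> point) set" where
  "aut_group A B C D =
     generate (BijGroup (cubic_surface A B C D)) {gx A B C D, gy A B C D, gz A B C D}"

definition converges_locally_uniformly ::
    "'a::metric_space set \<Rightarrow> (nat \<Rightarrow> 'a \<Rightarrow> 'a) \<Rightarrow> bool" where
  "converges_locally_uniformly U f \<longleftrightarrow>
     (\<exists>g. \<forall>K. compact K \<and> K \<subseteq> U \<longrightarrow> uniform_limit K f g sequentially)"

definition converges_to_infinity ::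
    "'a::metric_space set \<Rightarrow> 'a set \<Rightarrow> (nat \<Rightarrow> 'a \<Rightarrow> 'a) \<Rightarrow> bool" where
  "converges_to_infinity S U f \<longleftrightarrow>
     (\<forall>V K. compact V \<and> V \<subseteq> U \<and> compact K \<and> K \<subseteq> S \<longrightarrow> finite {i. f i ` V \<inter> K \<noteq> {}})"

definition normal_family_on ::
    "'a::metric_space set \<Rightarrow> ('a \<Rightarrow> 'a) set \<Rightarrow> 'a set \<Rightarrow> bool" where
  "normal_family_on S G U \<longleftrightarrow>
     (\<forall>f :: nat \<Rightarrow> 'a \<Rightarrow> 'a. range f \<subseteq> G \<longrightarrow>
        (\<exists>r :: nat \<Rightarrow> nat. strict_mono r \<and>
           (converges_locally_uniformly U (f \<circ> r) \<or> converges_to_infinity S U (f \<circ> r))))"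

definition fatou_set :: "complex \<Rightarrow> complex \<Rightarrow> complex \<Rightarrow> complex \<Rightarrow> point set" where
  "fatou_set A B C D =
     {p \<in> cubic_surface A B C D.
        \<exists>U. openin (top_of_set (cubic_surface A B C D)) U \<and> p \<in> U \<and>
            normal_family_on (cubic_surface A B C D) (aut_group A B C D) U}"

lemma sx_surface: "p \<in> cubic_surface A B C D \<Longrightarrow> sx A p \<in> cubic_surface A B C D"
  by (cases p) (simp add: cubic_surface_def sx_def power2_eq_square algebra_simps)

lemma sy_surface: "p \<in> cubic_surface A B C D \<Longrightarrow> sy B p \<in> cubic_surface A B C D"
  by (cases p) (simp add: cubic_surface_def sy_def power2_eq_square algebra_simps)

lemma sz_surface: "p \<in> cubic_surface A B C D \<Longrightarrow> sz C p \<in> cubic_surface A B C D"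
  by (cases p) (simp add: cubic_surface_def sz_def power2_eq_square algebra_simps)

lemma sx_sx [simp]: "sx A (sx A p) = p"
  by (cases p) (simp add: sx_def)

lemma sy_sy [simp]: "sy B (sy B p) = p"
  by (cases p) (simp add: sy_def)

lemma sz_sz [simp]: "sz C (sz C p) = p"
  by (cases p) (simp add: sz_def)

lemma gx_Bij: "gx A B C D \<in> Bij (cubic_surface A B C D)"
  unfolding gx_def Bij_def
  by (auto intro!: bij_betw_byWitness[where f' = "sy B \<circ> sz C"] simp: sy_surface sz_surface)

lemma gy_Bij: "gy A B C D \<in> Bij (cubic_surface A B C D)"
  unfolding gy_def Bij_def
  by (auto intro!: bij_betw_byWitness[where f' = "sz C \<circ> sx A"] simp: sx_surface sz_surface)

lemma gz_Bij: "gz A B C D \<in> Bij (cubic_surface A B C D)"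
  unfolding gz_def Bij_def
  by (auto intro!: bij_betw_byWitness[where f' = "sx A \<circ> sy B"] simp: sx_surface sy_surface)

lemma subgroup_aut_group: "subgroup (aut_group A B C D) (BijGroup (cubic_surface A B C D))"
  unfolding aut_group_def
  by (rule group.generate_is_subgroup[OF group_BijGroup])
     (simp add: BijGroup_def gx_Bij gy_Bij gz_Bij)

end

theory Submission
  imports Defs
begin

text \<open>
  For fixed \<open>z\<close> with \<open>|z| > 2\<close> the orbit of \<open>(x, y)\<close> under the involutions
  \<open>s\<^sub>x, s\<^sub>y\<close> is a second-order linear recurrence whose moduli grow in both directions
  as soon as they grow in one step each way and \<open>(|z| - 2) |x|\<close> exceeds \<open>|A|, |B|\<close>. If moreover \<open>|x|\<close> is large, applying
  \<open>s\<^sub>z\<close> produces a triple of large entries, and from then on every reduced word increases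
  the largest entry. So a neighbourhood of such a point escapes every bounded set under all but
  finitely many group elements. These points exist when \<open>z\<close> is close to \<open>2\<close> in
  case (1) and to \<open>-2\<close> in case (2), because the minimal \<open>|x|\<close> over the recurrence then
  tends to infinity.
\<close>

section \<open>Reduced words in the three involutions\<close>

datatype coord = X | Y | Z

lemma finite_UNIV_coord: "finite (UNIV :: coord set)"
proof -
  have "(UNIV :: coord set) = {X, Y, Z}"
    using coord.exhaust by blast
  then show ?thesis by (metis finite.emptyI finite_insert)
qed

fun reflect :: "complex \<Rightarrow> complex \<Rightarrow> complex \<Rightarrow> coord \<Rightarrow> point \<Rightarrow> point" where
  "reflect A B C X = sx A"
| "reflect A B C Y = sy B"
| "reflect A B C Z = sz C"

abbreviation act :: "complex \<Rightarrow> complex \<Rightarrow> complex \<Rightarrow> coord list \<Rightarrow> point \<Rightarrow> point" where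
  "act A B C \<equiv> foldr (reflect A B C)"

lemma reflect_reflect [simp]: "reflect A B C k (reflect A B C k p) = p"
  by (cases k) auto

lemma reflect_surface:
  "p \<in> cubic_surface A B C D \<Longrightarrow> reflect A B C k p \<in> cubic_surface A B C D"
  by (cases k) (auto simp: sx_surface sy_surface sz_surface)

lemma act_surface:
  "p \<in> cubic_surface A B C D \<Longrightarrow> act A B C w p \<in> cubic_surface A B C D"
  by (induction w) (auto simp: reflect_surface)

lemma act_rev_act [simp]: "act A B C (rev w) (act A B C w p) = p"
  by (induction w arbitrary: p) auto

lemma act_act_rev [simp]: "act A B C w (act A B C (rev w) p) = p"
  using act_rev_act[of A B C "rev w"] by simp

text \<open>Each letter acts as an involution, so a letter put in front of an equal one cancels
  it.\<close>

lemma act_reduced: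
  obtains v where "distinct_adj v" "act A B C v = act A B C w"
proof -
  have "\<exists>v. distinct_adj v \<and> act A B C v = act A B C w"
  proof (induction w)
    case Nil
    show ?case by (rule exI[of _ "[]"]) simp
  next
    case (Cons k w)
    then obtain v where v: "distinct_adj v" "act A B C v = act A B C w" by blast
    show ?case
    proof (cases "v \<noteq> [] \<and> hd v = k")
      case True
      then obtain v' where v': "v = k # v'" by (cases v) auto
      have "act A B C v' = act A B C (k # w)"
        by (simp add: v(2)[symmetric] v' fun_eq_iff)
      moreover have "distinct_adj v'" using v(1) v' by (cases v') auto
      ultimately show ?thesis by blast
    next
      case False
      then have "distinct_adj (k # v)" using v(1) by (cases v) auto
      moreover have "act A B C (k # v) = act A B C (k # w)" using v(2) by simp
      ultimately show ?thesis by blast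
    qed
  qed
  then show ?thesis using that by blast
qed

lemma restrict_act_Bij:
  "restrict (act A B C w) (cubic_surface A B C D) \<in> Bij (cubic_surface A B C D)"
  unfolding Bij_def
  by (auto intro!: bij_betw_byWitness[where f' = "act A B C (rev w)"] simp: act_surface)

lemma BijGroup_mult_act:
  fixes A B C D
  defines "S \<equiv> cubic_surface A B C D"
  shows "restrict (act A B C v) S \<otimes>\<^bsub>BijGroup S\<^esub> restrict (act A B C w) S
           = restrict (act A B C (v @ w)) S"
  using restrict_act_Bij[of A B C _ D]
  by (auto simp: BijGroup_def S_def compose_def restrict_def fun_eq_iff act_surface)

text \<open>Each generator is a word of length two, composition concatenates words, and
  \<open>rev\<close> inverts them.\<close>

lemma aut_group_word:
  assumes "f \<in> aut_group A B C D"
  obtains w where "f = restrict (act A B C w) (cubic_surface A B C D)"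
proof -
  let ?S = "cubic_surface A B C D"
  let ?r = "\<lambda>w. restrict (act A B C w) ?S"
  have unit: "\<one>\<^bsub>BijGroup ?S\<^esub> = ?r []"
    by (auto simp: BijGroup_def restrict_def fun_eq_iff)
  have gens: "gx A B C D = ?r [Z, Y]" "gy A B C D = ?r [X, Z]" "gz A B C D = ?r [Y, X]"
    by (auto simp: gx_def gy_def gz_def restrict_def fun_eq_iff)
  have carrier: "?r w \<in> carrier (BijGroup ?S)" for w
    using restrict_act_Bij by (simp add: BijGroup_def)
  have inverse: "inv\<^bsub>BijGroup ?S\<^esub> (?r w) = ?r (rev w)" for w
  proof (rule group.inv_equality[OF group_BijGroup _ carrier carrier])
    show "?r (rev w) \<otimes>\<^bsub>BijGroup ?S\<^esub> ?r w = \<one>\<^bsub>BijGroup ?S\<^esub>"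
      unfolding BijGroup_mult_act unit by (auto simp: restrict_def fun_eq_iff)
  qed
  have "\<exists>w. f = ?r w"
    using assms unfolding aut_group_def
  proof (induction rule: generate.induct)
    case one
    show ?case using unit by blast
  next
    case (incl h)
    then show ?case using gens by blast
  next
    case (inv h)
    then obtain w where "h = ?r w" using gens by blast
    then show ?case using inverse by metis
  next
    case (eng h1 h2)
    then show ?case using BijGroup_mult_act by blast
  qed
  then show ?thesis using that by blast
qed

section \<open>Growth of the dominant entry along reduced words\<close>

text \<open>
  The coordinate \<open>k\<close> is the one changed last. The second alternative for \<open>z\<close>
  describes orbit points where no \<open>s\<^sub>z\<close> has been applied yet.
\<close>

fun dominant :: "real \<Rightarrow> real \<Rightarrow> coord \<Rightarrow> point \<Rightarrow> bool" where
  "dominant m d X (x, y, z) \<longleftrightarrow> m \<le> cmod y \<and> cmod y \<le> cmod x \<and>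
     (m \<le> cmod z \<and> cmod z \<le> cmod x \<or> 2 + d \<le> cmod z \<and> cmod z \<le> 3)"
| "dominant m d Y (x, y, z) \<longleftrightarrow> m \<le> cmod x \<and> cmod x \<le> cmod y \<and>
     (m \<le> cmod z \<and> cmod z \<le> cmod y \<or> 2 + d \<le> cmod z \<and> cmod z \<le> 3)"
| "dominant m d Z (x, y, z) \<longleftrightarrow>
     m \<le> cmod x \<and> cmod x \<le> cmod z \<and> m \<le> cmod y \<and> cmod y \<le> cmod z"

fun entry :: "coord \<Rightarrow> point \<Rightarrow> complex" where
  "entry X (x, y, z) = x"
| "entry Y (x, y, z) = y"
| "entry Z (x, y, z) = z"

lemma norm_entry_le: "cmod (entry k p) \<le> norm p"
proof -
  obtain x y z where p: "p = (x, y, z)" by (cases p)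
  have "norm (y, z) \<le> norm p" "cmod x \<le> norm p"
    unfolding p using norm_snd_le norm_fst_le by blast+
  moreover have "cmod y \<le> norm (y, z)" "cmod z \<le> norm (y, z)"
    using norm_snd_le norm_fst_le by blast+
  ultimately show ?thesis by (cases k) (auto simp: p)
qed

lemma norm_reflection_ge:
  "cmod (- u - v * w + c) \<ge> cmod v * cmod w - cmod u - cmod c" for u v w c :: complex
proof -
  have "cmod (v * w) \<le> cmod (- u - v * w + c) + cmod u + cmod c"
    using norm_triangle_ineq4[of c "- u - v * w + c"]
      norm_triangle_ineq4[of "c - (- u - v * w + c)" u]
    by simp
  then show ?thesis by (simp add: norm_mult)
qed

text \<open>\<open>m\<close> is the threshold for a large entry, \<open>d\<close> the excess of |z|
  over 2, and \<open>\<delta>\<close> the gain guaranteed per letter. \<open>m_ge\<close> yields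
  growth when both factors of the product are large, \<open>gap\<close> when one factor is z with
  |z| only slightly above 2.\<close>

locale escape =
  fixes A B C :: complex and K m d \<delta> :: real
  assumes norm_A: "cmod A \<le> K" and norm_B: "cmod B \<le> K" and norm_C: "cmod C \<le> K"
    and m_ge: "K + 4 \<le> m" and gap: "K + \<delta> \<le> d * m"
    and d_pos: "0 < d" and \<delta>_pos: "0 < \<delta>" and \<delta>_le: "\<delta> \<le> 1"
begin

text \<open>Since v \<ge> 4, at least 3w - K remains, and w \<ge> K + 4 absorbs K +
  \<open>\<delta>\<close>.\<close>

lemma growth_large:
  fixes u v w c :: real
  assumes "m \<le> v" "v \<le> w" "u \<le> w" "c \<le> K"
  shows "v * w - u - c \<ge> w + \<delta>"
proof -
  have K: "0 \<le> K" using norm_A norm_ge_zero order_trans by blast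
  have "4 * w \<le> v * w" using assms m_ge K by (intro mult_right_mono) auto
  then show ?thesis using assms m_ge K \<delta>_le by linarith
qed

lemma growth_large':
  fixes u v w c :: real
  assumes "m \<le> v" "v \<le> w" "u \<le> w" "c \<le> K"
  shows "w * v - u - c \<ge> w + \<delta>"
  using growth_large[OF assms] by (simp add: mult.commute)

text \<open>vw is at least 2v + dv; one v pays for u, and dv \<ge> dm pays for K +
  \<open>\<delta>\<close>.\<close>

lemma growth_slow:
  fixes u v w c :: real
  assumes "2 + d \<le> w" "m \<le> v" "u \<le> v" "c \<le> K"
  shows "v * w - u - c \<ge> v + \<delta>"
proof -
  have K: "0 \<le> K" using norm_A norm_ge_zero order_trans by blast
  have "v * (2 + d) \<le> v * w" using assms m_ge K by (intro mult_left_mono) auto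
  moreover have "d * m \<le> d * v" using assms d_pos by (intro mult_left_mono) auto
  ultimately show ?thesis using assms gap by (simp add: algebra_simps)
qed

text \<open>As k differs from l, the dominant entry is a factor of the product that enters the new
  coordinate. \<open>growth_slow\<close> occurs only between X and Y; once Z is applied, all entries
  are large.\<close>

lemma dominant_step:
  assumes "dominant m d l p" "k \<noteq> l"
  shows "dominant m d k (reflect A B C k p) \<and>
         cmod (entry k (reflect A B C k p)) \<ge> cmod (entry l p) + \<delta>"
proof -
  obtain x y z where p: "p = (x, y, z)" by (cases p)
  have K: "0 \<le> K" using norm_A norm_ge_zero order_trans by blast
  have rx: "cmod (- x - y * z + A) \<ge> cmod y * cmod z - cmod x - cmod A"
    and ry: "cmod (- y - x * z + B) \<ge> cmod x * cmod z - cmod y - cmod B"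
    and rz: "cmod (- z - x * y + C) \<ge> cmod x * cmod y - cmod z - cmod C"
    by (rule norm_reflection_ge)+
  note bounds = rx ry rz norm_A norm_B norm_C \<delta>_pos m_ge K
  show ?thesis
  proof (cases l; cases k)
    assume l: "l = X" and k: "k = Y"
    have "cmod x * cmod z - cmod y - cmod B \<ge> cmod x + \<delta>"
      using assms(1) norm_B growth_slow growth_large' unfolding l p by fastforce
    then show ?thesis using assms(1) bounds unfolding l k p by (auto simp: sy_def)
  next
    assume l: "l = Y" and k: "k = X"
    have "cmod y * cmod z - cmod x - cmod A \<ge> cmod y + \<delta>"
      using assms(1) norm_A growth_slow growth_large' unfolding l p by fastforce
    then show ?thesis using assms(1) bounds unfolding l k p by (auto simp: sx_def)
  next
    assume l: "l = X" and k: "k = Z"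
    \<comment> \<open>In the second alternative for z, |z| \<le> 3 < m \<le> |x|; this is the
      purpose of the bound 3.\<close>
    have "cmod x * cmod y - cmod z - cmod C \<ge> cmod x + \<delta>"
      by (rule growth_large') (use assms(1) bounds in \<open>auto simp: l p\<close>)
    then show ?thesis using assms(1) bounds unfolding l k p by (auto simp: sz_def)
  next
    assume l: "l = Y" and k: "k = Z"
    have "cmod x * cmod y - cmod z - cmod C \<ge> cmod y + \<delta>"
      by (rule growth_large) (use assms(1) bounds in \<open>auto simp: l p\<close>)
    then show ?thesis using assms(1) bounds unfolding l k p by (auto simp: sz_def)
  next
    assume l: "l = Z" and k: "k = X"
    have "cmod y * cmod z - cmod x - cmod A \<ge> cmod z + \<delta>"
      by (rule growth_large) (use assms(1) bounds in \<open>auto simp: l p\<close>)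
    then show ?thesis using assms(1) bounds unfolding l k p by (auto simp: sx_def)
  next
    assume l: "l = Z" and k: "k = Y"
    have "cmod x * cmod z - cmod y - cmod B \<ge> cmod z + \<delta>"
      by (rule growth_large) (use assms(1) bounds in \<open>auto simp: l p\<close>)
    then show ?thesis using assms(1) bounds unfolding l k p by (auto simp: sy_def)
  qed (use assms(2) in auto)
qed

text \<open>\<open>foldr\<close> applies the last letter first: \<open>last w\<close> must differ
  from l, and \<open>hd w\<close> is the coordinate changed last. Reducedness lets
  \<open>dominant_step\<close> apply at every letter.\<close>

lemma dominant_act:
  assumes "dominant m d l p" "distinct_adj w" "w = [] \<or> last w \<noteq> l"
  defines "k \<equiv> if w = [] then l else hd w"
  shows "dominant m d k (act A B C w p) \<and>
         cmod (entry k (act A B C w p)) \<ge> \<delta> * length w"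
  using assms(2,3) unfolding k_def
proof (induction w)
  case Nil
  then show ?case using assms(1) by simp
next
  case (Cons i w)
  let ?k = "if w = [] then l else hd w"
  have "distinct_adj w" using Cons.prems by (cases w) auto
  then have IH: "dominant m d ?k (act A B C w p)"
    "cmod (entry ?k (act A B C w p)) \<ge> \<delta> * length w"
    using Cons by (auto split: if_splits)
  have "i \<noteq> ?k" using Cons.prems by (cases w) auto
  from dominant_step[OF IH(1) this] IH(2) show ?case by (simp add: algebra_simps)
qed

section \<open>Normality on an open region of escaping points\<close>

text \<open>Here |x| is a strict local minimum of the recurrence: both y and its image under
  \<open>sy B\<close> are larger. Strict inequalities make the region open.\<close>

definition wandering_region :: "point set" where
  "wandering_region = {(x, y, z). m < cmod x \<and> cmod x < cmod y \<and>
     cmod x < cmod (- y - x * z + B) \<and> 2 + d < cmod z \<and> cmod z < 3}"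

lemma open_wandering_region: "open wandering_region"
  unfolding wandering_region_def case_prod_beta
  by (intro open_Collect_conj open_Collect_less continuous_intros)

text \<open>If Y is applied first, that letter only moves p to \<open>sy B p\<close>, which is again
  dominant at Y; this accounts for the lost 1.\<close>

lemma norm_act_ge:
  assumes "p \<in> wandering_region" "distinct_adj w"
  shows "norm (act A B C w p) \<ge> \<delta> * (real (length w) - 1)"
proof -
  obtain x y z where p: "p = (x, y, z)" by (cases p)
  have start: "dominant m d Y p" "dominant m d Y (sy B p)"
    using assms(1) by (auto simp: wandering_region_def p sy_def)
  have entry_norm: "r \<le> norm q" if "r \<le> cmod (entry k q)" for r k q
    using that norm_entry_le order_trans by blast
  show ?thesis
  proof (cases "w = [] \<or> last w \<noteq> Y")
    case True
    from dominant_act[OF start(1) assms(2) this]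
    have "\<delta> * length w \<le> norm (act A B C w p)"
      by (intro entry_norm) (erule conjunct2)
    then show ?thesis using \<delta>_pos by (simp add: right_diff_distrib)
  next
    case False
    then obtain v where w: "w = v @ [Y]" by (metis append_butlast_last_id)
    have "distinct_adj v" "v = [] \<or> last v \<noteq> Y"
      using assms(2) by (auto simp: w distinct_adj_append_iff)
    from dominant_act[OF start(2) this]
    have "\<delta> * length v \<le> norm (act A B C v (sy B p))"
      by (intro entry_norm) (erule conjunct2)
    then show ?thesis by (simp add: w)
  qed
qed

text \<open>A bound on the image norm bounds the length of a reduced word, and three letters form
  finitely many words of bounded length.\<close>

lemma finite_returning:
  fixes D R
  defines "S \<equiv> cubic_surface A B C D"
  shows "finite {f \<in> aut_group A B C D. \<exists>p \<in> S \<inter> wandering_region. norm (f p) \<le> R}"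
proof -
  define N where "N = nat \<lceil>R / \<delta> + 1\<rceil>"
  have "f \<in> (\<lambda>w. restrict (act A B C w) S) ` {w. set w \<subseteq> UNIV \<and> length w \<le> N}"
    if f: "f \<in> aut_group A B C D" and p: "p \<in> S \<inter> wandering_region" "norm (f p) \<le> R" for f p
  proof -
    from f obtain w' where "f = restrict (act A B C w') S"
      unfolding S_def by (rule aut_group_word)
    then obtain w where w: "f = restrict (act A B C w) S" "distinct_adj w"
      by (metis act_reduced)
    have "\<delta> * (real (length w) - 1) \<le> R"
      using norm_act_ge[OF _ w(2), of p] p by (auto simp: w(1))
    then have "real (length w) - 1 \<le> R / \<delta>"
      using \<delta>_pos by (simp add: field_simps)
    then have "length w \<le> N" unfolding N_def by linarith
    then show ?thesis using w(1) by blast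
  qed
  then have "{f \<in> aut_group A B C D. \<exists>p \<in> S \<inter> wandering_region. norm (f p) \<le> R}
      \<subseteq> (\<lambda>w. restrict (act A B C w) S) ` {w. set w \<subseteq> UNIV \<and> length w \<le> N}"
    by blast
  then show ?thesis
    by (rule finite_subset) (intro finite_imageI finite_lists_length_le finite_UNIV_coord)
qed

text \<open>Either some map recurs infinitely often and gives a constant subsequence, or each map
  occurs finitely often and \<open>finite_returning\<close> sends the whole sequence to
  infinity.\<close>

lemma normal_family_wandering_region:
  "normal_family_on (cubic_surface A B C D) (aut_group A B C D)
     (cubic_surface A B C D \<inter> wandering_region)" (is "normal_family_on ?S ?G ?U")
  unfolding normal_family_on_def
proof (intro allI impI)
  fix f :: "nat \<Rightarrow> point \<Rightarrow> point"
  assume f: "range f \<subseteq> ?G"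
  show "\<exists>r. strict_mono r \<and>
    (converges_locally_uniformly ?U (f \<circ> r) \<or> converges_to_infinity ?S ?U (f \<circ> r))"
  proof (cases "\<exists>g. infinite {i. f i = g}")
    case True
    then obtain g where g: "infinite {i. f i = g}" by blast
    let ?r = "enumerate {i. f i = g}"
    have "f (?r n) = g" for n using enumerate_in_set[OF g, of n] by simp
    then have "uniform_limit L (f \<circ> ?r) g sequentially" for L
      by (simp add: o_def uniform_limit_const)
    then have "converges_locally_uniformly ?U (f \<circ> ?r)"
      unfolding converges_locally_uniformly_def by blast
    then show ?thesis using strict_mono_enumerate[OF g] by blast
  next
    case False
    have "converges_to_infinity ?S ?U (f \<circ> id)"
      unfolding converges_to_infinity_def
    proof (intro allI impI)
      fix V L :: "point set"
      assume VL: "compact V \<and> V \<subseteq> ?U \<and> compact L \<and> L \<subseteq> ?S"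
      then obtain R where R: "\<And>q. q \<in> L \<Longrightarrow> norm q \<le> R"
        by (meson bounded_iff compact_imp_bounded)
      let ?F = "{g \<in> ?G. \<exists>p \<in> ?U. norm (g p) \<le> R}"
      have "f i \<in> ?F" if "(f \<circ> id) i ` V \<inter> L \<noteq> {}" for i
      proof -
        from that obtain p where p: "p \<in> V" "f i p \<in> L" by auto
        then have "p \<in> ?U" "norm (f i p) \<le> R" using VL R by blast+
        then show ?thesis using f by blast
      qed
      then have "{i. (f \<circ> id) i ` V \<inter> L \<noteq> {}} \<subseteq> (\<Union>g\<in>?F. {i. f i = g})"
        by blast
      moreover have "finite (\<Union>g\<in>?F. {i. f i = g})"
        by (rule finite_UN_I[OF finite_returning]) (use False in blast)
      ultimately show "finite {i. (f \<circ> id) i ` V \<inter> L \<noteq> {}}" by (rule finite_subset)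
    qed
    then show ?thesis using strict_mono_id by blast
  qed
qed

lemma wandering_region_subset_fatou_set:
  "cubic_surface A B C D \<inter> wandering_region \<subseteq> fatou_set A B C D"
  unfolding fatou_set_def
  using normal_family_wandering_region open_wandering_region
  by (blast intro: openin_open_Int)

end

section \<open>Persistence under perturbation of the parameters\<close>

text \<open>
  The discriminant is that of the surface equation as a quadratic in \<open>y\<close>. At the base
  parameters its double root is the turning point of the recurrence, so that \<open>y\<close> and
  its conjugate root both stay outside the disc of radius \<open>|x|\<close> after perturbation.
\<close>

lemma fatou_nonempty_near:
  fixes A0 B0 C0 D0 x z :: complex and K m d \<delta> :: real
  assumes disc: "(B0 - x * z)\<^sup>2 = 4 * (x\<^sup>2 + z\<^sup>2 - A0 * x - C0 * z - D0)"
    and turn: "2 * cmod x < cmod (B0 - x * z)"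
    and base: "cmod A0 < K" "cmod B0 < K" "cmod C0 < K"
    and x: "m < cmod x" and z: "2 + d < cmod z" "cmod z < 3"
    and margins: "K + 4 \<le> m" "K + \<delta> \<le> d * m" "0 < d" "0 < \<delta>" "\<delta> \<le> 1"
  shows "\<exists>W. open W \<and> (A0, B0, C0, D0) \<in> W \<and> (\<forall>(A, B, C, D) \<in> W. fatou_set A B C D \<noteq> {})"
proof -
  define \<Delta> where "\<Delta> = (\<lambda>(A, B, C, D). (B - x * z)\<^sup>2 - 4 * (x\<^sup>2 + z\<^sup>2 - A * x - C * z - D))"
  \<comment> \<open>x and z stay fixed while the parameters vary. Both roots have modulus at least
    half of |B - xz| - |s|, so this inequality keeps them above |x|; at the base point it reduces to
    \<open>turn\<close>.\<close>
  define W where "W = {(A, B, C, D). 2 * cmod x + sqrt (cmod (\<Delta> (A, B, C, D))) < cmod (B - x * z)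
      \<and> cmod A < K \<and> cmod B < K \<and> cmod C < K}"
  have "open W"
    unfolding W_def \<Delta>_def case_prod_beta
    by (intro open_Collect_conj open_Collect_less continuous_intros)
  moreover have "(A0, B0, C0, D0) \<in> W"
    using assms by (simp add: W_def \<Delta>_def)
  moreover have "fatou_set A B C D \<noteq> {}" if "(A, B, C, D) \<in> W" for A B C D
  proof -
    define s where "s = csqrt (\<Delta> (A, B, C, D))"
    define y where "y = (B - x * z + s) / 2"
    \<comment> \<open>By Vieta, \<open>sy B\<close> exchanges the two roots.\<close>
    have conjugate: "- y - x * z + B = (B - x * z - s) / 2"
      by (simp add: y_def field_simps)
    have s2: "s\<^sup>2 = (B - x * z)\<^sup>2 - 4 * (x\<^sup>2 + z\<^sup>2 - A * x - C * z - D)"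
      by (simp add: s_def \<Delta>_def)
    have W: "2 * cmod x + cmod s < cmod (B - x * z)" "cmod A < K" "cmod B < K" "cmod C < K"
      using that by (auto simp: W_def s_def norm_csqrt)
    interpret escape A B C K m d \<delta>
      using W margins by unfold_locales auto
    have "2 * y - (B - x * z) = s" by (simp add: y_def field_simps)
    then have "(2 * y - (B - x * z))\<^sup>2 = s\<^sup>2" by simp
    then have "4 * (y\<^sup>2 - (B - x * z) * y + (x\<^sup>2 + z\<^sup>2 - A * x - C * z - D)) = 0"
      unfolding s2 by (simp add: power2_eq_square algebra_simps)
    then have "y\<^sup>2 - (B - x * z) * y + (x\<^sup>2 + z\<^sup>2 - A * x - C * z - D) = 0"
      by (subst (asm) mult_eq_0_iff) simp
    then have "(x, y, z) \<in> cubic_surface A B C D"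
      by (simp add: cubic_surface_def algebra_simps)
    moreover have "cmod x < cmod y"
      using W(1) norm_triangle_ineq2[of "B - x * z" "- s"] by (simp add: y_def norm_divide)
    moreover have "cmod x < cmod (- y - x * z + B)"
      unfolding conjugate
      using W(1) norm_triangle_ineq2[of "B - x * z" s] by (simp add: norm_divide)
    ultimately show ?thesis
      using wandering_region_subset_fatou_set[of D] x z by (auto simp: wandering_region_def)
  qed
  ultimately show ?thesis by blast
qed

section \<open>The two parameter families\<close>

text \<open>The vanishing discriminant reads (z^2 - 4) x^2 = 4 (z^2 - D0). As D0 differs from 4, the
  right side stays away from 0 near z = 2, which forces |x| to be large.\<close>

lemma fatou_nonempty_near_Markov:
  fixes D0 :: complex
  assumes "D0 \<noteq> 4"
  shows "\<exists>W. open W \<and> (0, 0, 0, D0) \<in> W \<and> (\<forall>(A, B, C, D) \<in> W. fatou_set A B C D \<noteq> {})"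
proof -
  \<comment> \<open>The factor 50 gives 10e \<le> |D0 - 4| for e = z^2 - 4 \<le> 5
    \<open>\<epsilon>\<close>, hence |x|^2 \<ge> 36.\<close>
  define \<epsilon> where "\<epsilon> = min (1/2) (cmod (D0 - 4) / 50)"
  have \<epsilon>: "0 < \<epsilon>" "\<epsilon> \<le> 1/2" "50 * \<epsilon> \<le> cmod (D0 - 4)"
    using assms by (auto simp: \<epsilon>_def)
  define e where "e = 4 * \<epsilon> + \<epsilon>\<^sup>2"
  have "\<epsilon>\<^sup>2 \<le> \<epsilon>" using \<epsilon> by (simp add: power2_eq_square mult_left_le)
  then have e: "0 < e" "10 * e \<le> cmod (D0 - 4)"
    using \<epsilon> by (auto simp: e_def intro!: add_pos_nonneg)
  define z where "z = complex_of_real (2 + \<epsilon>)"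
  have z2: "z\<^sup>2 = 4 + of_real e"
    by (simp add: z_def e_def power2_eq_square algebra_simps)
  have nz: "cmod z = 2 + \<epsilon>" using \<epsilon> unfolding z_def norm_of_real by simp
  define x where "x = csqrt (4 * (z\<^sup>2 - D0) / of_real e)"
  have x2: "x\<^sup>2 = 4 * (z\<^sup>2 - D0) / of_real e" by (simp add: x_def)
  have "cmod (D0 - 4) \<le> cmod (D0 - z\<^sup>2) + e"
    using norm_triangle_ineq[of "D0 - z\<^sup>2" "of_real e"] e(1) by (simp add: z2)
  then have "9 * e \<le> cmod (D0 - z\<^sup>2)" using e by simp
  then have "25 < 4 * cmod (D0 - z\<^sup>2) / e" using e(1) by (simp add: field_simps)
  also have "4 * cmod (D0 - z\<^sup>2) / e = (cmod x)\<^sup>2"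
    unfolding norm_power[symmetric] x2 norm_divide norm_mult norm_minus_commute[of D0]
    using e(1) by simp
  finally have "5\<^sup>2 < (cmod x)\<^sup>2" by simp
  then have x5: "5 < cmod x" by (rule power_less_imp_less_base) simp
  have "of_real e * x\<^sup>2 = 4 * (z\<^sup>2 - D0)" using e(1) by (simp add: x2)
  then have "(z\<^sup>2 - 4) * x\<^sup>2 = 4 * (z\<^sup>2 - D0)" by (simp add: z2)
  then have disc: "(0 - x * z)\<^sup>2 = 4 * (x\<^sup>2 + z\<^sup>2 - 0 * x - 0 * z - D0)"
    by (simp add: power_mult_distrib algebra_simps)
  have "0 < cmod x * \<epsilon>" using x5 \<epsilon>(1) by (intro mult_pos_pos) auto
  then have turn: "2 * cmod x < cmod (0 - x * z)"
    by (simp add: norm_mult nz distrib_left)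
  show ?thesis
    \<comment> \<open>With A = B = C = 0 any positive K will do; the gap condition becomes 2
      \<open>\<epsilon>\<close> \<le> 5/2 \<open>\<epsilon>\<close>.\<close>
    by (rule fatou_nonempty_near[OF disc turn, where K = "\<epsilon>" and m = 5 and d = "\<epsilon> / 2" and \<delta> = "\<epsilon>"])
       (use \<epsilon> x5 in \<open>simp_all add: nz\<close>)
qed

text \<open>
  Here the recurrence is centred at \<open>x\<^sup>* = A / (z + 2)\<close>, itself unbounded as
  \<open>z\<close> tends to \<open>-2\<close>; the turning point is \<open>2 x\<^sup>* - 2\<close>.
\<close>

lemma fatou_nonempty_near_three_nodes:
  fixes a :: real
  assumes "- 2 < a"
  defines "A \<equiv> complex_of_real (2 * a + 4)" and "D \<equiv> complex_of_real (- (a\<^sup>2 + 8 * a + 8))"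
  shows "\<exists>W. open W \<and> (A, A, A, D) \<in> W \<and> (\<forall>(A, B, C, D) \<in> W. fatou_set A B C D \<noteq> {})"
proof -
  define s where "s = 2 * a + 4"
  have s: "0 < s" using assms by (simp add: s_def)
  \<comment> \<open>This choice makes the turning point equal to -2s - 10, so |x| exceeds any m up
    to 2s + 9.\<close>
  define \<epsilon> where "\<epsilon> = s / (s + 4)"
  have \<epsilon>: "0 < \<epsilon>" "\<epsilon> < 1" "s / \<epsilon> = s + 4" using s by (auto simp: \<epsilon>_def)
  define xr where "xr = - (2 * (s / \<epsilon>) + 2)"
  define zr where "zr = - 2 - \<epsilon>"
  define x where "x = complex_of_real xr"
  define z where "z = complex_of_real zr"
  have sq: "s = \<epsilon> * (s + 4)" using \<epsilon> by (simp add: field_simps)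
  have a: "2 * a = s - 4" by (simp add: s_def)
  have xr: "xr = - 2 * s - 10" by (simp add: xr_def \<epsilon>)
  have zx: "xr * zr = 2 * s * \<epsilon> + 10 * \<epsilon> + 4 * s + 20"
    by (simp add: xr zr_def algebra_simps)
  have turning: "xr * (zr + 2) = 2 * s - 2 * (zr + 2)"
    using sq by (simp add: xr zr_def algebra_simps)
  \<comment> \<open>The discriminant factors as (x - 2)(z - 2)((x + 2)(z + 2) - 2s), and
    \<open>turning\<close> says that the last factor vanishes.\<close>
  have "(s - xr * zr)\<^sup>2 = 4 * (xr\<^sup>2 + zr\<^sup>2 - s * xr - s * zr - (- (a\<^sup>2 + 8 * a + 8)))"
    using turning a by algebra
  then have "complex_of_real ((s - xr * zr)\<^sup>2)
      = of_real (4 * (xr\<^sup>2 + zr\<^sup>2 - s * xr - s * zr - (- (a\<^sup>2 + 8 * a + 8))))"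
    by (rule arg_cong)
  then have disc: "(A - x * z)\<^sup>2 = 4 * (x\<^sup>2 + z\<^sup>2 - A * x - A * z - D)"
    unfolding A_def D_def x_def z_def s_def[symmetric]
    by (simp only: of_real_diff of_real_mult of_real_add of_real_power of_real_numeral)
  have "cmod x = \<bar>xr\<bar>" "cmod z = \<bar>zr\<bar>" "cmod A = \<bar>s\<bar>"
    unfolding x_def z_def A_def s_def norm_of_real by simp_all
  then have norms: "cmod x = 2 * s + 10" "cmod z = 2 + \<epsilon>" "cmod A = s"
    using s \<epsilon> by (simp_all add: xr zr_def)
  have "A - x * z = complex_of_real (s - xr * zr)"
    by (simp add: A_def x_def z_def s_def)
  then have "cmod (A - x * z) = \<bar>s - xr * zr\<bar>"
    by (metis norm_of_real)
  moreover have "s - xr * zr < - (4 * s + 20)"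
    using sq \<epsilon> s by (simp add: zx algebra_simps)
  ultimately have turn: "2 * cmod x < cmod (A - x * z)"
    by (simp add: norms)
  show ?thesis
    \<comment> \<open>By \<open>sq\<close>, dm = 3/2 s, which is split into K = 5/4 s and at most
      s/4 for \<open>\<delta>\<close>.\<close>
    by (rule fatou_nonempty_near[OF disc turn, where K = "5 / 4 * s" and m = "2 * s + 8"
          and d = "3 / 4 * \<epsilon>" and \<delta> = "min 1 (s / 4)"])
       (use s \<epsilon> sq in \<open>simp_all add: norms min_def algebra_simps\<close>)
qed

theorem theoremE:
  shows "(\<forall>D0 :: complex. D0 \<noteq> 4 \<longrightarrow>
            (\<exists>W :: (complex \<times> complex \<times> complex \<times> complex) set.
               open W \<and> (0, 0, 0, D0) \<in> W \<and>
               (\<forall>(A, B, C, D) \<in> W. fatou_set A B C D \<noteq> {})))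
       \<and> (\<forall>a :: real. - 2 < a \<and> a < 2 \<longrightarrow>
            (\<exists>W :: (complex \<times> complex \<times> complex \<times> complex) set.
               open W \<and>
               (complex_of_real (2 * a + 4), complex_of_real (2 * a + 4),
                complex_of_real (2 * a + 4), complex_of_real (- (a\<^sup>2 + 8 * a + 8))) \<in> W \<and>
               (\<forall>(A, B, C, D) \<in> W. fatou_set A B C D \<noteq> {})))"
  using fatou_nonempty_near_Markov fatou_nonempty_near_three_nodes by blast

end
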